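(* Let $\mathcal{R}$ be a commutative ring with identity and let $F \in \mathcal{R}[x]$ be a polynomial of degree $d$. Then there exists a sequence of multivariate polynomials $f_m = f_m(x_1,\dots,x_m) \in \mathcal{R}[x_1,\dots,x_m]$, $m \ge 0$, such that $f_0 = 1$, $f_1(x_1) = F(x_1)$, for all $m \ge 2$ $$f_m = f_{m-2} + x_m \sum_{j=1}^d \frac{1}{j!}\left(x_m \frac{f_{m-1}}{f_{m-2}}\right)^{j-1} \frac{\partial^j f_{m-1}}{\partial x_{m-1}^j},$$ and for all $m \ge 1$ $$F\left(\sum_{k=1}^m x_k\, f_{k-1}(x_1,\dots,x_{k-1})\right) = f_{m-1}(x_1,\dots,x_{m-1})\, f_m(x_1,\dots,x_m).$$ Here the recurrence is read as follows: there are polynomials $Q_{m,j} \in \mathcal{R}[x_1,\dots,x_{m-1}]$ ($m \ge 2$, $1 \le j \le d$) with $f_{m-2}^{\,j-1} Q_{m,j} = D^{(j)}_{x_{m-1}} f_{m-1}$ and $f_m = f_{m-2} + x_m \sum_{j=1}^d (x_m f_{m-1})^{j-1} Q_{m,j}$.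
   Context: $D^{(j)}_{x}$ denotes the $j$th order Hasse derivative with respect to the variable $x$: the linear map (over the ring of polynomials in the remaining variables) with $D^{(j)}_x x^i = \binom{i}{j} x^{i-j}$ (zero if $i<j$). It is the meaning of $\frac{1}{j!}\frac{\partial^j}{\partial x^j}$ over a general commutative ring. $f_m$ is shorthand for $f_m(x_1,\dots,x_m)$. Zeroth powers are $1$, and empty sums are $0$. *)

theory Defs
  imports "HOL-Library.Poly_Mapping" "HOL-Computational_Algebra.Polynomial"
begin

text \<open>
  Multivariate polynomials in variables indexed by the natural numbers, as finitely supported
  maps from monomials (finitely supported exponent vectors) to coefficients. The ring structure
  is the convolution product of \<^theory>\<open>HOL-Library.Poly_Mapping\<close>.
\<close>

type_synonym 'a mpoly = "(nat \<Rightarrow>\<^sub>0 nat) \<Rightarrow>\<^sub>0 'a"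

definition Const :: "'a::zero \<Rightarrow> 'a mpoly" where
  "Const c = Poly_Mapping.single 0 c"

definition Var :: "nat \<Rightarrow> 'a::zero_neq_one mpoly" where
  "Var i = Poly_Mapping.single (Poly_Mapping.single i 1) 1"

definition vars :: "'a::zero mpoly \<Rightarrow> nat set" where
  "vars p = (\<Union>t \<in> Poly_Mapping.keys p. Poly_Mapping.keys t)"

text \<open>The subring of polynomials in the variables with indices \<open>1, \<dots>, m\<close>
  (the constants if \<open>m = 0\<close>).\<close>

definition polys_upto :: "nat \<Rightarrow> 'a::zero mpoly set" where
  "polys_upto m = {p. vars p \<subseteq> {1..m}}"

text \<open>
  The \<open>j\<close>-th order Hasse derivative with respect to the variable with index \<open>i\<close>. If the
  exponent of that variable in the monomial \<open>t\<close> is less than \<open>j\<close>, then the subtraction of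
  exponents is truncated, but the binomial coefficient makes the summand vanish.
\<close>

definition hasse_deriv :: "nat \<Rightarrow> nat \<Rightarrow> 'a::comm_semiring_1 mpoly \<Rightarrow> 'a mpoly" where
  "hasse_deriv i j p = (\<Sum>t \<in> Poly_Mapping.keys p.
     Poly_Mapping.single (t - Poly_Mapping.single i j)
       (of_nat (Poly_Mapping.lookup t i choose j) * Poly_Mapping.lookup p t))"

definition eval_at :: "'a::comm_ring_1 poly \<Rightarrow> 'a mpoly \<Rightarrow> 'a mpoly" where
  "eval_at F q = poly (map_poly Const F) q"

text \<open>The following facts characterise the Hasse derivative: it is additive, and
  for \<open>q\<close> free of \<open>x\<^sub>i\<close> it maps \<open>x\<^sub>i\<^sup>n q\<close> to \<open>(n choose j) x\<^sub>i\<^sup>n\<^sup>-\<^sup>j q\<close>.\<close>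

lemma hasse_deriv_superset:
  assumes "finite A" "Poly_Mapping.keys p \<subseteq> A"
  shows "hasse_deriv i j p = (\<Sum>t \<in> A.
     Poly_Mapping.single (t - Poly_Mapping.single i j)
       (of_nat (Poly_Mapping.lookup t i choose j) * Poly_Mapping.lookup p t))"
  unfolding hasse_deriv_def
  by (rule sum.mono_neutral_left) (use assms in \<open>auto simp: in_keys_iff\<close>)

lemma hasse_deriv_add: "hasse_deriv i j (p + q) = hasse_deriv i j p + hasse_deriv i j q"
proof -
  let ?A = "Poly_Mapping.keys p \<union> Poly_Mapping.keys q"
  have "Poly_Mapping.keys (p + q) \<subseteq> ?A" by (rule Poly_Mapping.keys_add)
  then show ?thesis
    by (subst (1 2 3) hasse_deriv_superset[where A = ?A])
      (auto simp: lookup_add distrib_left single_add sum.distrib)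
qed

lemma hasse_deriv_single:
  "hasse_deriv i j (Poly_Mapping.single t c) =
     Poly_Mapping.single (t - Poly_Mapping.single i j)
       (of_nat (Poly_Mapping.lookup t i choose j) * c)"
  by (subst hasse_deriv_superset[where A = "{t}"]) auto

lemma Var_power: "(Var i :: 'a::comm_semiring_1 mpoly) ^ n = Poly_Mapping.single (Poly_Mapping.single i n) 1"
  by (induction n) (auto simp: Var_def mult_single single_add[symmetric])

lemma hasse_deriv_sum: "hasse_deriv i j (sum g A) = (\<Sum>a\<in>A. hasse_deriv i j (g a))"
proof (induction A rule: infinite_finite_induct)
  case (insert x F)
  then show ?case by (simp add: hasse_deriv_add)
qed (simp_all add: hasse_deriv_def)

lemma hasse_deriv_Var_power_mult:
  fixes q :: "'a::comm_semiring_1 mpoly"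
  assumes "i \<notin> vars q"
  shows "hasse_deriv i j (Var i ^ n * q) = of_nat (n choose j) * Var i ^ (n - j) * q"
proof -
  have q: "q = (\<Sum>t\<in>Poly_Mapping.keys q. Poly_Mapping.single t (Poly_Mapping.lookup q t))"
    by (rule poly_mapping_eqI)
      (auto simp: lookup_sum lookup_single when_def sum.delta in_keys_iff)
  have *: "hasse_deriv i j (Var i ^ n * Poly_Mapping.single t c)
      = of_nat (n choose j) * Var i ^ (n - j) * Poly_Mapping.single t c"
    if "t \<in> Poly_Mapping.keys q" for t and c :: 'a
  proof -
    have t: "Poly_Mapping.lookup t i = 0"
      using that assms by (auto simp: vars_def in_keys_iff)
    have e: "Poly_Mapping.single i n + t - Poly_Mapping.single i j
        = Poly_Mapping.single i (n - j) + t" if "j \<le> n"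
      using that t
      by (intro poly_mapping_eqI) (auto simp: lookup_add lookup_minus lookup_single when_def)
    show ?thesis
    proof (cases "j \<le> n")
      case True
      have c: "(of_nat (n choose j) :: 'a mpoly) = Poly_Mapping.single 0 (of_nat (n choose j))"
        by (rule single_of_nat[symmetric])
      show ?thesis
        by (simp only: c Var_power mult_single hasse_deriv_single lookup_add t e[OF True]
          lookup_single_eq add_0_right add_0_left mult_1_right mult_1_left)
    next
      case False
      then show ?thesis
        by (simp add: Var_power mult_single hasse_deriv_single lookup_add t binomial_eq_0)
    qed
  qed
  have "hasse_deriv i j (Var i ^ n * q) =
      (\<Sum>t\<in>Poly_Mapping.keys q.
         hasse_deriv i j (Var i ^ n * Poly_Mapping.single t (Poly_Mapping.lookup q t)))"
    by (subst q) (simp only: sum_distrib_left hasse_deriv_sum)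
  also have "\<dots> = (\<Sum>t\<in>Poly_Mapping.keys q. of_nat (n choose j) * Var i ^ (n - j) *
      Poly_Mapping.single t (Poly_Mapping.lookup q t))"
    by (rule sum.cong[OF refl *])
  also have "\<dots> = of_nat (n choose j) * Var i ^ (n - j) * q"
    by (simp only: q[symmetric] sum_distrib_left[symmetric])
  finally show ?thesis .
qed

end

theory Submission
  imports Defs
begin

text \<open>
  The idea is a Taylor expansion. Put \<open>s\<^sub>m = \<Sum>k=1..m. x\<^sub>k f\<^sub>k\<^sub>-\<^sub>1\<close>, and let \<open>t\<^sub>j(s)\<close> be the \<open>j\<close>-th
  Taylor coefficient of \<open>F\<close> at \<open>s\<close>, so that \<open>F(s + h) = \<Sum>j\<le>d. h\<^sup>j t\<^sub>j(s)\<close>. If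
  \<open>F(s\<^sub>m) = f\<^sub>m\<^sub>-\<^sub>1 f\<^sub>m\<close>, then expanding at \<open>s\<^sub>m\<close> with the increment \<open>h = x\<^sub>m\<^sub>+\<^sub>1 f\<^sub>m\<close> gives
  \<open>F(s\<^sub>m\<^sub>+\<^sub>1) = f\<^sub>m\<^sub>-\<^sub>1 f\<^sub>m + (\<Sum>j=1..d. (x\<^sub>m\<^sub>+\<^sub>1 f\<^sub>m)\<^sup>j t\<^sub>j(s\<^sub>m))\<close>. Every summand is divisible by \<open>f\<^sub>m\<close>,
  so the factorisation continues with
  \<open>f\<^sub>m\<^sub>+\<^sub>1 = f\<^sub>m\<^sub>-\<^sub>1 + x\<^sub>m\<^sub>+\<^sub>1 (\<Sum>j=1..d. (x\<^sub>m\<^sub>+\<^sub>1 f\<^sub>m)\<^bsup>j-1\<^esup> t\<^sub>j(s\<^sub>m))\<close>. It can be started at \<open>m = 0\<close>, with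
  \<open>s\<^sub>0 = 0\<close>, \<open>f\<^sub>0 = 1\<close> and the extra term \<open>f\<^sub>-\<^sub>1 = F(0)\<close>.

  The polynomials \<open>t\<^sub>j(s\<^sub>m)\<close> serve as the quotients of \<open>D\<^sup>(\<^sup>j\<^sup>) f\<^sub>m\<close> by \<open>f\<^sub>m\<^sub>-\<^sub>1\<^bsup>j-1\<^esup>\<close>. One is
  tempted to derive this by differentiating \<open>F(s\<^sub>m) = f\<^sub>m\<^sub>-\<^sub>1 f\<^sub>m\<close> and cancelling \<open>f\<^sub>m\<^sub>-\<^sub>1\<close>, but \<open>f\<^sub>m\<^sub>-\<^sub>1\<close>
  may be a zero divisor. Instead, the formula that defines \<open>f\<^sub>m\<close> displays it as a polynomial
  in \<open>x\<^sub>m\<close> whose coefficients are free of \<open>x\<^sub>m\<close>. Differentiating it term by term yields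
  \<open>f\<^sub>m\<^sub>-\<^sub>1\<^bsup>j-1\<^esup> (\<Sum>i\<le>d. (i choose j) (x\<^sub>m f\<^sub>m\<^sub>-\<^sub>1)\<^bsup>i-j\<^esup> t\<^sub>i(s\<^sub>m\<^sub>-\<^sub>1))\<close>, and the sum is the expansion of
  \<open>t\<^sub>j(s\<^sub>m\<^sub>-\<^sub>1 + x\<^sub>m f\<^sub>m\<^sub>-\<^sub>1) = t\<^sub>j(s\<^sub>m)\<close>, by \<open>taylor_coeff_add\<close>.
\<close>

section \<open>Taylor coefficients over a commutative ring\<close>

text \<open>
  Reading the coefficients off the polynomial \<open>p(s + y)\<close> in \<open>y\<close> avoids division by factorials
  and turns a change of centre into associativity of composition.
\<close>

definition taylor_coeff :: "'b::comm_ring_1 poly \<Rightarrow> 'b \<Rightarrow> nat \<Rightarrow> 'b" where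
  "taylor_coeff p s j = coeff (p \<circ>\<^sub>p [:s, 1:]) j"

lemma degree_pcompose_shift_le: "degree (p \<circ>\<^sub>p [:s, 1:]) \<le> degree (p :: 'b::comm_ring_1 poly)"
  using degree_pcompose_le[of p "[:s, 1:]"] by simp

lemma poly_add_taylor:
  fixes p :: "'b::comm_ring_1 poly"
  assumes "degree p \<le> d"
  shows "poly p (s + h) = (\<Sum>j\<le>d. h ^ j * taylor_coeff p s j)"
proof -
  let ?q = "p \<circ>\<^sub>p [:s, 1:]"
  have "degree ?q \<le> d"
    using degree_pcompose_shift_le assms by (rule order.trans)
  then have "poly ?q h = (\<Sum>j\<le>d. poly (monom (coeff ?q j) j) h)"
    by (subst poly_as_sum_of_monoms'[symmetric]) (auto simp: poly_sum)
  then show ?thesis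
    by (simp add: poly_pcompose taylor_coeff_def poly_monom mult.commute)
qed

lemma taylor_coeff_0: "taylor_coeff p s 0 = poly p s"
  by (simp add: taylor_coeff_def)

lemma pcompose_monom: "monom c n \<circ>\<^sub>p q = smult c (q ^ n)"
  for q :: "'b::comm_ring_1 poly"
  by (induction n) (simp_all add: monom_0 monom_Suc pcompose_pCons)

lemma taylor_coeff_eq_sum:
  fixes p :: "'b::comm_ring_1 poly"
  assumes "degree p \<le> d"
  shows "taylor_coeff p h j = (\<Sum>i\<le>d. of_nat (i choose j) * h ^ (i - j) * coeff p i)"
proof -
  have lin: "coeff ([:h, 1:] ^ i) j = of_nat (i choose j) * h ^ (i - j)" for i
  proof (cases "j \<le> i")
    case True
    then show ?thesis by (simp add: coeff_linear_poly_power)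
  next
    case False
    have "degree ([:h, 1:] ^ i) \<le> i"
      using degree_power_le[of "[:h, 1:]" i] by simp
    then show ?thesis using False by (simp add: coeff_eq_0 binomial_eq_0)
  qed
  have "p \<circ>\<^sub>p [:h, 1:] = (\<Sum>i\<le>d. smult (coeff p i) ([:h, 1:] ^ i))"
    by (subst poly_as_sum_of_monoms'[OF assms, symmetric])
      (simp only: pcompose_sum pcompose_monom)
  then show ?thesis
    by (simp add: taylor_coeff_def coeff_sum lin mult_ac)
qed

text \<open>
  \<open>p(s + h + y)\<close> is \<open>p(s + z)\<close> composed with \<open>z = h + y\<close>, so its coefficients in \<open>y\<close> are the
  Taylor coefficients at \<open>h\<close> of the polynomial \<open>p(s + z)\<close> in \<open>z\<close>.
\<close>

lemma taylor_coeff_add: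
  fixes p :: "'b::comm_ring_1 poly"
  assumes "degree p \<le> d"
  shows "taylor_coeff p (s + h) j =
    (\<Sum>i\<le>d. of_nat (i choose j) * h ^ (i - j) * taylor_coeff p s i)"
proof -
  have "p \<circ>\<^sub>p [:s + h, 1:] = (p \<circ>\<^sub>p [:s, 1:]) \<circ>\<^sub>p [:h, 1:]"
    by (simp add: pcompose_assoc[symmetric] pcompose_pCons)
  then have "taylor_coeff p (s + h) j = taylor_coeff (p \<circ>\<^sub>p [:s, 1:]) h j"
    by (simp add: taylor_coeff_def)
  also have "\<dots> = (\<Sum>i\<le>d. of_nat (i choose j) * h ^ (i - j) * coeff (p \<circ>\<^sub>p [:s, 1:]) i)"
    using degree_pcompose_shift_le assms by (intro taylor_coeff_eq_sum) (rule order.trans)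
  finally show ?thesis by (simp add: taylor_coeff_def)
qed

section \<open>The subring of polynomials in the first variables\<close>

lemma vars_add: "vars (p + q) \<subseteq> vars p \<union> vars q"
  using Poly_Mapping.keys_add[of p q] by (fastforce simp: vars_def)

lemma vars_mult: "vars (p * q) \<subseteq> vars p \<union> vars q"
proof
  fix i assume "i \<in> vars (p * q)"
  then obtain t where t: "t \<in> Poly_Mapping.keys (p * q)" "i \<in> Poly_Mapping.keys t"
    by (auto simp: vars_def)
  then obtain u v where "t = u + v" "u \<in> Poly_Mapping.keys p" "v \<in> Poly_Mapping.keys q"
    using keys_mult[of p q] by blast
  then show "i \<in> vars p \<union> vars q"
    using t Poly_Mapping.keys_add[of u v] by (fastforce simp: vars_def)
qed

lemma polys_upto_add: "p \<in> polys_upto m \<Longrightarrow> q \<in> polys_upto m \<Longrightarrow> p + q \<in> polys_upto m"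
  using vars_add[of p q] by (auto simp: polys_upto_def)

lemma polys_upto_mult: "p \<in> polys_upto m \<Longrightarrow> q \<in> polys_upto m \<Longrightarrow> p * q \<in> polys_upto m"
  using vars_mult[of p q] by (auto simp: polys_upto_def)

lemma polys_upto_0: "0 \<in> polys_upto m"
  by (simp add: polys_upto_def vars_def)

lemma polys_upto_Const: "Const c \<in> polys_upto m"
  by (simp add: polys_upto_def vars_def Const_def)

lemma Const_1: "Const (1::'a::comm_ring_1) = 1"
  by (simp add: Const_def)

lemma polys_upto_1: "(1 :: 'a::comm_ring_1 mpoly) \<in> polys_upto m"
  using polys_upto_Const[of "1::'a"] by (simp add: Const_1)

lemma polys_upto_of_nat: "(of_nat n :: 'a::comm_ring_1 mpoly) \<in> polys_upto m"
  by (induction n) (auto intro: polys_upto_0 polys_upto_1 polys_upto_add)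

lemma polys_upto_power: "p \<in> polys_upto m \<Longrightarrow> p ^ n \<in> polys_upto m"
  for p :: "'a::comm_ring_1 mpoly"
  by (induction n) (auto intro: polys_upto_1 polys_upto_mult)

lemma polys_upto_sum: "(\<And>i. i \<in> A \<Longrightarrow> g i \<in> polys_upto m) \<Longrightarrow> sum g A \<in> polys_upto m"
  by (induction A rule: infinite_finite_induct) (auto intro: polys_upto_0 polys_upto_add)

lemma polys_upto_Var: "i \<in> {1..m} \<Longrightarrow> (Var i :: 'a::comm_ring_1 mpoly) \<in> polys_upto m"
  by (simp add: polys_upto_def vars_def Var_def)

lemma polys_upto_mono: "p \<in> polys_upto m \<Longrightarrow> m \<le> n \<Longrightarrow> p \<in> polys_upto n"
  by (force simp: polys_upto_def)

lemma Suc_notin_vars_polys_upto: "p \<in> polys_upto m \<Longrightarrow> Suc m \<notin> vars p"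
  by (auto simp: polys_upto_def)

lemmas polys_upto_intros = polys_upto_add polys_upto_mult polys_upto_power polys_upto_sum
  polys_upto_of_nat polys_upto_Const polys_upto_Var

section \<open>Embedding the constants\<close>

lemma coeff_map_poly_Const: "coeff (map_poly Const F) i = Const (coeff F i)"
  by (simp add: coeff_map_poly Const_def)

lemma degree_map_poly_Const_le: "degree (map_poly Const F) \<le> degree F"
  by (rule degree_le) (simp add: coeff_map_poly_Const coeff_eq_0 Const_def)

lemma polys_upto_taylor_coeff:
  "s \<in> polys_upto m \<Longrightarrow> taylor_coeff (map_poly Const F) s j \<in> polys_upto m"
  for F :: "'a::comm_ring_1 poly"
  by (subst taylor_coeff_eq_sum[OF degree_map_poly_Const_le])
    (auto simp: coeff_map_poly_Const intro!: polys_upto_intros)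

section \<open>The sequence of factors\<close>

text \<open>
  The state after \<open>m\<close> steps is the triple of \<open>f\<^sub>m\<^sub>-\<^sub>1\<close>, \<open>f\<^sub>m\<close> and \<open>s\<^sub>m\<close>. The first component starts
  with \<open>f\<^sub>-\<^sub>1 = F(0)\<close>, so that the recurrence produces \<open>f\<^sub>1 = F(x\<^sub>1)\<close> too.
\<close>

primrec chain :: "'a::comm_ring_1 poly \<Rightarrow> nat \<Rightarrow> 'a mpoly \<times> 'a mpoly \<times> 'a mpoly" where
  "chain F 0 = (Const (coeff F 0), 1, 0)"
| "chain F (Suc m) = (case chain F m of (a, b, s) \<Rightarrow>
     (b,
      a + Var (Suc m) * (\<Sum>j=1..degree F.
        (Var (Suc m) * b) ^ (j - 1) * taylor_coeff (map_poly Const F) s j),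
      s + Var (Suc m) * b))"

definition prev_factor :: "'a::comm_ring_1 poly \<Rightarrow> nat \<Rightarrow> 'a mpoly" where
  "prev_factor F m = fst (chain F m)"

definition factor :: "'a::comm_ring_1 poly \<Rightarrow> nat \<Rightarrow> 'a mpoly" where
  "factor F m = fst (snd (chain F m))"

definition center :: "'a::comm_ring_1 poly \<Rightarrow> nat \<Rightarrow> 'a mpoly" where
  "center F m = snd (snd (chain F m))"

lemma factor_0: "factor F 0 = 1"
  by (simp add: factor_def)

lemma prev_factor_Suc: "prev_factor F (Suc m) = factor F m"
  by (simp add: prev_factor_def factor_def case_prod_unfold)

lemma center_Suc: "center F (Suc m) = center F m + Var (Suc m) * factor F m"
  by (simp add: center_def factor_def case_prod_unfold)

lemma factor_Suc:
  "factor F (Suc m) = prev_factor F m + Var (Suc m) * (\<Sum>j=1..degree F.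
     (Var (Suc m) * factor F m) ^ (j - 1) * taylor_coeff (map_poly Const F) (center F m) j)"
  by (simp add: prev_factor_def factor_def center_def case_prod_unfold)

lemma center_eq_sum: "center F m = (\<Sum>k=1..m. Var k * factor F (k - 1))"
proof (induction m)
  case 0
  then show ?case by (simp add: center_def)
next
  case (Suc m)
  then show ?case by (simp add: center_Suc)
qed

lemma chain_polys_upto:
  "prev_factor F m \<in> polys_upto m \<and> factor F m \<in> polys_upto m \<and> center F m \<in> polys_upto m"
proof (induction m)
  case 0
  then show ?case
    by (simp add: prev_factor_def factor_def center_def polys_upto_Const polys_upto_1 polys_upto_0)
next
  case (Suc m)
  then have "prev_factor F m \<in> polys_upto (Suc m)" "factor F m \<in> polys_upto (Suc m)"
    "center F m \<in> polys_upto (Suc m)"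
    by (auto elim: polys_upto_mono)
  then show ?case
    unfolding prev_factor_Suc factor_Suc center_Suc
    by (auto intro!: polys_upto_intros polys_upto_taylor_coeff)
qed

text \<open>
  Expanding \<open>F\<close> at \<open>s\<^sub>m\<close> with the increment \<open>x\<^sub>m\<^sub>+\<^sub>1 f\<^sub>m\<close>, the constant term \<open>F(s\<^sub>m)\<close> is divisible
  by \<open>f\<^sub>m\<close> by induction, the other terms because the increment is. The cofactor is \<open>f\<^sub>m\<^sub>+\<^sub>1\<close> by
  construction.
\<close>

lemma eval_at_center: "eval_at F (center F m) = prev_factor F m * factor F m"
proof (induction m)
  case 0
  then show ?case
    by (simp add: eval_at_def center_def prev_factor_def factor_def poly_0_coeff_0
        coeff_map_poly_Const)
next
  case (Suc m)
  let ?G = "map_poly Const F"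
  let ?b = "factor F m" and ?x = "Var (Suc m) :: 'a mpoly"
  let ?t = "taylor_coeff ?G (center F m)"
  have "eval_at F (center F (Suc m)) = (\<Sum>j\<le>degree F. (?x * ?b) ^ j * ?t j)"
    unfolding eval_at_def center_Suc by (rule poly_add_taylor[OF degree_map_poly_Const_le])
  also have "\<dots> = ?t 0 + (\<Sum>j=1..degree F. (?x * ?b) ^ j * ?t j)"
    by (simp add: sum.atMost_shift sum.atLeast1_atMost_eq lessThan_atLeast0)
  also have "?t 0 = prev_factor F m * ?b"
    using Suc by (simp add: taylor_coeff_0 eval_at_def)
  also have "(\<Sum>j=1..degree F. (?x * ?b) ^ j * ?t j)
      = (\<Sum>j=1..degree F. ?b * (?x * ((?x * ?b) ^ (j - 1) * ?t j)))"
  proof (rule sum.cong[OF refl])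
    fix j assume "j \<in> {1..degree F}"
    then have "(?x * ?b) ^ j = (?x * ?b) * (?x * ?b) ^ (j - 1)"
      by (cases j) auto
    then show "(?x * ?b) ^ j * ?t j = ?b * (?x * ((?x * ?b) ^ (j - 1) * ?t j))"
      by (simp only: mult_ac)
  qed
  also have "prev_factor F m * ?b + \<dots> = ?b * factor F (Suc m)"
    by (simp only: factor_Suc distrib_left sum_distrib_left mult.commute)
  finally show ?case by (simp only: prev_factor_Suc)
qed

lemma factor_1: "factor F 1 = eval_at F (Var 1)"
  using eval_at_center[of F 1] by (simp add: prev_factor_Suc factor_0 center_eq_sum)

section \<open>Hasse derivatives of the factors\<close>

text \<open>
  The variable \<open>x\<^sub>m\<^sub>+\<^sub>1\<close> occurs in \<open>f\<^sub>m\<^sub>+\<^sub>1\<close> only through the powers that \<open>factor_Suc\<close> displays, so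
  termwise differentiation applies. It kills \<open>f\<^sub>m\<^sub>-\<^sub>1\<close> because \<open>j \<ge> 1\<close>. In each surviving term
  \<open>i \<ge> j\<close>, hence \<open>f\<^sub>m\<^bsup>i-1\<^esup> = f\<^sub>m\<^bsup>j-1\<^esup> f\<^sub>m\<^bsup>i-j\<^esup>\<close>; the second factor combines with \<open>x\<^sub>m\<^sub>+\<^sub>1\<^bsup>i-j\<^esup>\<close> to the
  increment of the centre, and \<open>taylor_coeff_add\<close> moves the centre to \<open>s\<^sub>m\<^sub>+\<^sub>1\<close>.
\<close>

lemma hasse_deriv_factor_Suc:
  assumes "j \<ge> 1"
  shows "hasse_deriv (Suc m) j (factor F (Suc m)) =
    factor F m ^ (j - 1) * taylor_coeff (map_poly Const F) (center F (Suc m)) j"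
proof -
  let ?d = "degree F"
  let ?a = "prev_factor F m" and ?b = "factor F m" and ?x = "Var (Suc m) :: 'a mpoly"
  let ?t = "taylor_coeff (map_poly Const F) (center F m)"
  have upto: "?a \<in> polys_upto m" "?b \<in> polys_upto m" "?t i \<in> polys_upto m" for i
    using chain_polys_upto polys_upto_taylor_coeff by blast+
  have "?x * ((?x * ?b) ^ (i - 1) * ?t i) = ?x ^ i * (?b ^ (i - 1) * ?t i)" if "i \<ge> 1" for i
    using that by (cases i) (auto simp: power_mult_distrib mult_ac)
  then have "factor F (Suc m) = ?a + (\<Sum>i=1..?d. ?x ^ i * (?b ^ (i - 1) * ?t i))"
    unfolding factor_Suc sum_distrib_left by (intro arg_cong2[where f = "(+)"] sum.cong refl) simp
  moreover have "hasse_deriv (Suc m) j ?a = 0"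
    using hasse_deriv_Var_power_mult[OF Suc_notin_vars_polys_upto[OF upto(1)], of j 0] assms
    by (simp add: binomial_eq_0)
  moreover have "hasse_deriv (Suc m) j (?x ^ i * (?b ^ (i - 1) * ?t i)) =
      of_nat (i choose j) * ?x ^ (i - j) * (?b ^ (i - 1) * ?t i)" for i
    using upto by (intro hasse_deriv_Var_power_mult Suc_notin_vars_polys_upto polys_upto_intros)
  ultimately have "hasse_deriv (Suc m) j (factor F (Suc m)) =
      (\<Sum>i=1..?d. of_nat (i choose j) * ?x ^ (i - j) * (?b ^ (i - 1) * ?t i))"
    by (simp add: hasse_deriv_add hasse_deriv_sum)
  also have "\<dots> = (\<Sum>i=1..?d. ?b ^ (j - 1) * (of_nat (i choose j) * (?x * ?b) ^ (i - j) * ?t i))"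
  proof (rule sum.cong[OF refl])
    fix i
    show "of_nat (i choose j) * ?x ^ (i - j) * (?b ^ (i - 1) * ?t i) =
        ?b ^ (j - 1) * (of_nat (i choose j) * (?x * ?b) ^ (i - j) * ?t i)"
    proof (cases "j \<le> i")
      case True
      with assms have "?b ^ (i - 1) = ?b ^ (j - 1) * ?b ^ (i - j)"
        by (simp flip: power_add)
      then show ?thesis by (simp only: power_mult_distrib mult_ac)
    next
      case False
      then have "i choose j = 0" by (simp add: binomial_eq_0)
      then show ?thesis by (simp only: of_nat_0 mult_zero_left mult_zero_right)
    qed
  qed
  \<comment> \<open>The index \<open>i = 0\<close> may be added because \<open>0 choose j = 0\<close>.\<close>
  also have "\<dots> = (\<Sum>i\<le>?d. ?b ^ (j - 1) * (of_nat (i choose j) * (?x * ?b) ^ (i - j) * ?t i))"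
  proof (rule sum.mono_neutral_left)
    show "\<forall>i\<in>{..?d} - {1..?d}.
        ?b ^ (j - 1) * (of_nat (i choose j) * (?x * ?b) ^ (i - j) * ?t i) = 0"
    proof
      fix i assume "i \<in> {..?d} - {1..?d}"
      then have "i choose j = 0" using assms by (auto simp: not_le binomial_eq_0)
      then show "?b ^ (j - 1) * (of_nat (i choose j) * (?x * ?b) ^ (i - j) * ?t i) = 0"
        by (simp only: of_nat_0 mult_zero_left mult_zero_right)
    qed
  qed auto
  also have "\<dots> = ?b ^ (j - 1) * taylor_coeff (map_poly Const F) (center F (Suc m)) j"
    by (simp only: center_Suc taylor_coeff_add[OF degree_map_poly_Const_le] sum_distrib_left)
  finally show ?thesis .
qed

section \<open>Existence of the sequence\<close>

theorem theorem2p1: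
  fixes F :: "'a::comm_ring_1 poly" and d :: nat
  assumes "degree F = d"
  shows "\<exists>f :: nat \<Rightarrow> 'a mpoly.
    (\<forall>m. f m \<in> polys_upto m) \<and>
    f 0 = 1 \<and>
    f 1 = eval_at F (Var 1) \<and>
    (\<exists>Q :: nat \<Rightarrow> nat \<Rightarrow> 'a mpoly. \<forall>m\<ge>2.
       (\<forall>j\<in>{1..d}. Q m j \<in> polys_upto (m - 1) \<and>
          f (m - 2) ^ (j - 1) * Q m j = hasse_deriv (m - 1) j (f (m - 1))) \<and>
       f m = f (m - 2) + Var m * (\<Sum>j=1..d. (Var m * f (m - 1)) ^ (j - 1) * Q m j)) \<and>
    (\<forall>m\<ge>1. eval_at F (\<Sum>k=1..m. Var k * f (k - 1)) = f (m - 1) * f m)"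
proof (intro exI conjI allI impI)
  let ?Q = "\<lambda>m j. taylor_coeff (map_poly Const F) (center F (m - 1)) j"
  show "factor F m \<in> polys_upto m" for m
    using chain_polys_upto by blast
  show "factor F 0 = 1" by (rule factor_0)
  show "factor F 1 = eval_at F (Var 1)" by (rule factor_1)
  show "eval_at F (\<Sum>k=1..m. Var k * factor F (k - 1)) = factor F (m - 1) * factor F m"
    if "m \<ge> 1" for m
    using that eval_at_center[of F m] by (cases m) (simp_all add: prev_factor_Suc center_eq_sum)
  fix m :: nat assume "m \<ge> 2"
  then obtain k where m: "m = Suc (Suc k)"
    by (metis add_2_eq_Suc le_Suc_ex)
  show "\<forall>j\<in>{1..d}. ?Q m j \<in> polys_upto (m - 1) \<and>
      factor F (m - 2) ^ (j - 1) * ?Q m j = hasse_deriv (m - 1) j (factor F (m - 1))"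
    using chain_polys_upto[of F "m - 1"]
    by (auto simp: m hasse_deriv_factor_Suc intro: polys_upto_taylor_coeff)
  show "factor F m = factor F (m - 2) +
      Var m * (\<Sum>j=1..d. (Var m * factor F (m - 1)) ^ (j - 1) * ?Q m j)"
    using factor_Suc[of F "Suc k"] assms by (simp add: m prev_factor_Suc)
qed

end
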